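(* Every 2-dimensional complex multiplicative Hom-Lie algebra, with basis $\{a_1,a_2\}$, is isomorphic to one in the following classes: (a) abelian Hom-Lie algebras; (b) $[a_1,a_2] = -[a_2,a_1] = a_1$ and $\alpha$ is represented by a matrix $\begin{pmatrix} 0 & \alpha_{12} \\ 0 & \alpha_{22} \end{pmatrix}$ with $\alpha_{12},\alpha_{22}\in\mathbb{C}$; (c) $[a_1,a_2] = -[a_2,a_1] = a_1$ and $\alpha$ is represented by a matrix $\begin{pmatrix} \alpha_{11} & \alpha_{12} \\ 0 & 1 \end{pmatrix}$ with $\alpha_{11},\alpha_{12}\in\mathbb{C}$ and $\alpha_{11} \neq 0$.
   Context: A multiplicative Hom-Lie algebra $(L,[-,-],\alpha)$ over $\mathbb{C}$ is a complex vector space $L$ with a bilinear bracket and a linear map $\alpha:L\to L$ such that $[x,y]=-[y,x]$, $[\alpha(x),[y,z]]+[\alpha(z),[x,y]]+[\alpha(y),[z,x]]=0$ and $\alpha([x,y])=[\alpha(x),\alpha(y)]$ for all $x,y,z\in L$. It is abelian if the bracket is zero (with $\alpha$ any linear map). An isomorphism of Hom-Lie algebras is a bijective linear map $f$ that preserves brackets and satisfies $f\alpha_L=\alpha_{L'}f$. The matrix $(\alpha_{ij})$ represents $\alpha$ in the basis $\{a_1,a_2\}$ by $\alpha(a_i)=\sum_{l}\alpha_{li}a_l$. In (b) and (c) brackets not determined by those listed are zero. *)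

theory Defs
  imports "HOL-Analysis.Analysis"
begin

context vector_space
begin

definition basis_family :: "('i \<Rightarrow> 'b) \<Rightarrow> bool" where
  "basis_family a \<longleftrightarrow> inj a \<and> independent (range a) \<and> span (range a) = UNIV"

text \<open>Columns are images: the \<open>i\<close>-th column of \<open>A\<close> holds the coordinates of \<open>f (a i)\<close>.\<close>

definition represented_by :: "('i::finite \<Rightarrow> 'b) \<Rightarrow> ('b \<Rightarrow> 'b) \<Rightarrow> 'a ^ 'i ^ 'i \<Rightarrow> bool" where
  "represented_by a f A \<longleftrightarrow> (\<forall>i. f (a i) = (\<Sum>l\<in>UNIV. scale (A $ l $ i) (a l)))"

end

locale mult_hom_lie_algebra = vector_space scale
  for scale :: "complex \<Rightarrow> 'v::ab_group_add \<Rightarrow> 'v" +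
  fixes bracket :: "'v \<Rightarrow> 'v \<Rightarrow> 'v"
    and \<alpha> :: "'v \<Rightarrow> 'v"
  assumes linear_bracket_right: "\<And>x. Vector_Spaces.linear scale scale (\<lambda>y. bracket x y)"
    and linear_bracket_left: "\<And>y. Vector_Spaces.linear scale scale (\<lambda>x. bracket x y)"
    and linear_twist: "Vector_Spaces.linear scale scale \<alpha>"
    and skew: "\<And>x y. bracket x y = - bracket y x"
    and hom_jacobi: "\<And>x y z. bracket (\<alpha> x) (bracket y z) + bracket (\<alpha> z) (bracket x y)
                              + bracket (\<alpha> y) (bracket z x) = 0"
    and multiplicative: "\<And>x y. \<alpha> (bracket x y) = bracket (\<alpha> x) (\<alpha> y)"

definition hom_lie_isomorphism ::
  "(complex \<Rightarrow> 'v::ab_group_add \<Rightarrow> 'v) \<Rightarrow> ('v \<Rightarrow> 'v \<Rightarrow> 'v) \<Rightarrow> ('v \<Rightarrow> 'v) \<Rightarrow>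
   (complex \<Rightarrow> 'w::ab_group_add \<Rightarrow> 'w) \<Rightarrow> ('w \<Rightarrow> 'w \<Rightarrow> 'w) \<Rightarrow> ('w \<Rightarrow> 'w) \<Rightarrow>
   ('v \<Rightarrow> 'w) \<Rightarrow> bool" where
  "hom_lie_isomorphism s bracket \<alpha> s' bracket' \<alpha>' f \<longleftrightarrow>
     Vector_Spaces.linear s s' f \<and> bij f \<and>
     (\<forall>x y. f (bracket x y) = bracket' (f x) (f y)) \<and> f \<circ> \<alpha> = \<alpha>' \<circ> f"

text \<open>The brackets of basis vectors in the non-abelian classes; the two zero brackets
  are the ones not listed explicitly.  The index type \<open>2\<close> has exactly the elements
  \<open>1\<close> and \<open>2\<close>.\<close>

definition standard_bracket :: "(2 \<Rightarrow> 'v::ab_group_add) \<Rightarrow> ('v \<Rightarrow> 'v \<Rightarrow> 'v) \<Rightarrow> bool" where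
  "standard_bracket a bracket \<longleftrightarrow>
     bracket (a 1) (a 2) = a 1 \<and> bracket (a 2) (a 1) = - a 1 \<and>
     bracket (a 1) (a 1) = 0 \<and> bracket (a 2) (a 2) = 0"

end

theory Submission imports Defs begin

text \<open>
  Let \<open>w = [a\<^sub>1, a\<^sub>2]\<close>. By bilinearity and skew symmetry every bracket is a multiple of \<open>w\<close>.
  If \<open>w = 0\<close>, the algebra is abelian. Otherwise, write \<open>w = p a\<^sub>1 + q a\<^sub>2\<close>; since
  \<open>[w, a\<^sub>2] = p w\<close> and \<open>[w, - a\<^sub>1] = q w\<close>, with \<open>p\<close>, \<open>q\<close> not both zero, a suitable multiple \<open>u\<close> of
  \<open>a\<^sub>2\<close> or \<open>a\<^sub>1\<close> satisfies \<open>[w, u] = w\<close>. This relation alone makes \<open>(w, u)\<close> linearly independent,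
  hence a basis. The linear automorphism sending \<open>(w, u)\<close> to \<open>(a\<^sub>1, a\<^sub>2)\<close> transports the structure
  to an isomorphic one with the standard bracket.

  For the twist, \<open>\<alpha> w = [\<alpha> w, \<alpha> u]\<close> is a bracket, so \<open>\<alpha> w = k w\<close>. With \<open>\<alpha> u = m w + n u\<close>,
  the same identity reads \<open>k w = k n w\<close>, so \<open>k = 0\<close> (the first non-abelian class) or \<open>n = 1\<close>
  (the second).
\<close>

lemma (in vector_space) basis_family_2_coordinates:
  fixes a :: "2 \<Rightarrow> 'b"
  assumes "basis_family a"
  obtains p q where "x = scale p (a 1) + scale q (a 2)"
proof -
  have "range a = {a 1, a 2}"
    by (auto simp: UNIV_2)
  then have "x \<in> span {a 1, a 2}"
    using assms by (simp add: basis_family_def)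
  then obtain p q where "x - scale p (a 1) = scale q (a 2)"
    by (auto simp: span_insert span_singleton)
  then have "x = scale p (a 1) + scale q (a 2)"
    by (metis add.commute diff_add_cancel)
  then show ?thesis by (rule that)
qed

text \<open>The basis \<open>a\<close> only serves to say that the space has dimension two.\<close>

lemma (in vector_space) independent_pair_is_basis_family:
  fixes a b :: "2 \<Rightarrow> 'b"
  assumes a: "basis_family a"
    and indep: "\<And>s t. scale s (b 1) + scale t (b 2) = 0 \<Longrightarrow> s = 0 \<and> t = 0"
  shows "basis_family b"
proof -
  interpret finite_dimensional_vector_space scale "range a"
    using a by unfold_locales (auto simp: basis_family_def)
  have range_b: "range b = {b 1, b 2}"
    by (auto simp: UNIV_2)
  have ne: "b 1 \<noteq> b 2"
    using indep[of 1 "-1"] by auto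
  then have inj: "inj b"
    by (auto simp: inj_on_def UNIV_2)
  have indep_b: "independent (range b)"
    unfolding range_b
  proof -
    have "b 1 \<noteq> 0" "b 2 \<noteq> 0"
      using indep[of 1 0] indep[of 0 1] by auto
    moreover have "b 1 \<notin> span {b 2}"
    proof
      assume "b 1 \<in> span {b 2}"
      then obtain t where "b 1 = scale t (b 2)"
        by (auto simp: span_singleton)
      then show False
        using indep[of 1 "- t"] by simp
    qed
    ultimately show "independent {b 1, b 2}"
      by (simp add: independent_insert ne)
  qed
  have "dim UNIV = card (range a)"
    by (rule dim_UNIV)
  also have "\<dots> = card (range b)"
    using a inj by (simp add: basis_family_def card_image)
  finally have "UNIV \<subseteq> span (range b)"
    by (intro card_ge_dim_independent indep_b) auto
  with inj indep_b show ?thesis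
    by (auto simp: basis_family_def)
qed

lemma (in vector_space) linear_bij_between_basis_families:
  assumes a: "basis_family a" and b: "basis_family b"
  obtains f where "Vector_Spaces.linear scale scale f" "bij f" "\<And>i. f (b i) = a i"
proof -
  interpret vp: vector_space_pair scale scale ..
  have extend: "\<exists>f. Vector_Spaces.linear scale scale f \<and> (\<forall>i. f (c i) = d i)"
    if c: "basis_family c" for c d :: "'c \<Rightarrow> 'b"
  proof -
    from c have "independent (range c)" and inj: "inj c"
      by (auto simp: basis_family_def)
    from vp.linear_independent_extend[OF this(1), of "d \<circ> inv c"] inj show ?thesis
      by auto
  qed
  obtain f where f: "Vector_Spaces.linear scale scale f" "\<And>i. f (b i) = a i"
    using extend[OF b] by blast
  obtain g where g: "Vector_Spaces.linear scale scale g" "\<And>i. g (a i) = b i"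
    using extend[OF a] by blast
  have fg: "f (g x) = x" for x
  proof -
    have "(f \<circ> g) x = id x"
    proof (rule vp.linear_eq_on_span[OF Vector_Spaces.linear_compose[OF g(1) f(1)] linear_id])
      show "x \<in> span (range a)"
        using a by (simp add: basis_family_def)
      show "(f \<circ> g) z = id z" if "z \<in> range a" for z
        using that f(2) g(2) by auto
    qed
    then show ?thesis by simp
  qed
  have gf: "g (f x) = x" for x
  proof -
    have "(g \<circ> f) x = id x"
    proof (rule vp.linear_eq_on_span[OF Vector_Spaces.linear_compose[OF f(1) g(1)] linear_id])
      show "x \<in> span (range b)"
        using b by (simp add: basis_family_def)
      show "(g \<circ> f) z = id z" if "z \<in> range b" for z
        using that f(2) g(2) by auto
    qed
    then show ?thesis by simp
  qed
  have "bij f"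
    by (rule bijI') (metis gf, metis fg)
  then show ?thesis using f that by blast
qed

context mult_hom_lie_algebra
begin

lemma bracket_add_left: "bracket (x + y) z = bracket x z + bracket y z"
  using linear_bracket_left[of z] by (rule Vector_Spaces.linear.axioms(3)[THEN module_hom.add])

lemma bracket_scale_left: "bracket (scale c x) z = scale c (bracket x z)"
  using linear_bracket_left[of z] by (rule Vector_Spaces.linear.axioms(3)[THEN module_hom.scale])

lemma bracket_add_right: "bracket z (x + y) = bracket z x + bracket z y"
  using linear_bracket_right[of z] by (rule Vector_Spaces.linear.axioms(3)[THEN module_hom.add])

lemma bracket_scale_right: "bracket z (scale c x) = scale c (bracket z x)"
  using linear_bracket_right[of z] by (rule Vector_Spaces.linear.axioms(3)[THEN module_hom.scale])

lemmas bracket_bilinear =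
  bracket_add_left bracket_scale_left bracket_add_right bracket_scale_right

lemma bracket_self: "bracket x x = 0"
proof -
  have "scale 2 (bracket x x) = bracket x x + bracket x x"
    by (metis one_add_one scale_left_distrib scale_one)
  also have "\<dots> = 0"
    using skew[of x x] by (metis add.right_inverse)
  finally show ?thesis by simp
qed

text \<open>On the span of two vectors the bracket is the determinant of the coordinates.\<close>

lemma bracket_combinations:
  "bracket (scale p x + scale q y) (scale r x + scale s y) = scale (p * s - q * r) (bracket x y)"
  using skew[of y x]
  by (simp add: bracket_bilinear bracket_self scale_left_diff_distrib algebra_simps)

text \<open>Bracketing \<open>s x + t y = 0\<close> with \<open>y\<close> kills the second term, bracketing with \<open>x\<close> the first.\<close>

lemma bracket_eq_left_independent:
  assumes "bracket x y = x" "x \<noteq> 0" "scale s x + scale t y = 0"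
  shows "s = 0 \<and> t = 0"
proof -
  have "scale s x = bracket (scale s x + scale t y) y"
    by (simp add: bracket_bilinear bracket_self assms(1))
  also have "\<dots> = 0"
    using bracket_scale_left[of 0 0 y] by (simp add: assms(3))
  finally have "s = 0" using assms(2) by simp
  moreover have "scale t x = bracket x (scale s x + scale t y)"
    by (simp add: bracket_bilinear bracket_self assms(1))
  then have "scale t x = 0"
    using bracket_scale_right[of x 0 0] by (simp add: assms(3))
  ultimately show ?thesis using assms(2) by simp
qed

text \<open>A nonzero bracket can be normalised: \<open>w = [a\<^sub>1, a\<^sub>2]\<close> is the first member of a basis
  whose bracket is \<open>w\<close> again.\<close>

lemma normalised_basis_exists:
  fixes a :: "2 \<Rightarrow> 'v"
  assumes a: "basis_family a" and w: "bracket (a 1) (a 2) \<noteq> 0"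
  obtains b :: "2 \<Rightarrow> 'v" where "basis_family b" "b 1 = bracket (a 1) (a 2)"
    "bracket (b 1) (b 2) = b 1"
proof -
  let ?w = "bracket (a 1) (a 2)"
  obtain p q where pq: "?w = scale p (a 1) + scale q (a 2)"
    using basis_family_2_coordinates[OF a] by blast
  have det: "bracket ?w (scale r (a 1) + scale s (a 2)) = scale (p * s - q * r) ?w" for r s
    \<comment> \<open>Only the left argument is expanded; \<open>?w\<close> on the right-hand side stays.\<close>
    by (subst (1) pq) (rule bracket_combinations)
  have "\<exists>u. bracket ?w u = ?w"
  proof (cases "p = 0")
    case True
    with pq w have "q \<noteq> 0" by auto
    with True det[of "- 1 / q" 0] show ?thesis by auto
  next
    case False
    with det[of 0 "1 / p"] show ?thesis by auto
  qed
  then obtain u where u: "bracket ?w u = ?w" by blast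
  define b :: "2 \<Rightarrow> 'v" where "b = (\<lambda>i. if i = 1 then ?w else u)"
  have b: "b 1 = ?w" "b 2 = u" by (auto simp: b_def)
  have "basis_family b"
    using independent_pair_is_basis_family[OF a, of b] bracket_eq_left_independent[OF u w]
    by (auto simp: b)
  with b u that show ?thesis by metis
qed

text \<open>Transport of the structure along a linear automorphism \<open>f\<close>.\<close>

lemma transport:
  assumes f: "Vector_Spaces.linear scale scale f" "bij f"
  defines "bracket' \<equiv> \<lambda>x y. f (bracket (inv f x) (inv f y))"
    and "\<alpha>' \<equiv> f \<circ> \<alpha> \<circ> inv f"
  shows "mult_hom_lie_algebra scale bracket' \<alpha>'"
    and "hom_lie_isomorphism scale bracket \<alpha> scale bracket' \<alpha>' f"
proof -
  interpret f: Vector_Spaces.linear scale scale f by (rule f(1))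
  have inv_f [simp]: "inv f (f x) = x" "f (inv f x) = x" for x
    using f(2) by (simp_all add: bij_is_inj bij_is_surj surj_f_inv_f)
  have lin_inv: "Vector_Spaces.linear scale scale (inv f)"
  proof unfold_locales
    show "inv f (x + y) = inv f x + inv f y" for x y
      by (metis f.add inv_f)
    show "inv f (scale c x) = scale c (inv f x)" for c x
      by (metis f.scale inv_f)
  qed
  note comp = Vector_Spaces.linear_compose[OF lin_inv Vector_Spaces.linear_compose[OF _ f(1)],
    unfolded comp_def]
  show "mult_hom_lie_algebra scale bracket' \<alpha>'"
  proof (intro mult_hom_lie_algebra.intro mult_hom_lie_algebra_axioms.intro)
    show "vector_space scale" ..
    show "Vector_Spaces.linear scale scale (\<lambda>y. bracket' x y)" for x
      unfolding bracket'_def by (rule comp[OF linear_bracket_right])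
    show "Vector_Spaces.linear scale scale (\<lambda>x. bracket' x y)" for y
      unfolding bracket'_def by (rule comp[OF linear_bracket_left])
    show "Vector_Spaces.linear scale scale \<alpha>'"
      unfolding \<alpha>'_def comp_def by (rule comp[OF linear_twist])
    show "bracket' x y = - bracket' y x" for x y
      unfolding bracket'_def by (subst skew) (rule f.neg)
    show "bracket' (\<alpha>' x) (bracket' y z) + bracket' (\<alpha>' z) (bracket' x y)
        + bracket' (\<alpha>' y) (bracket' z x) = 0" for x y z
      by (simp add: bracket'_def \<alpha>'_def hom_jacobi f.zero flip: f.add)
    show "\<alpha>' (bracket' x y) = bracket' (\<alpha>' x) (\<alpha>' y)" for x y
      by (simp add: bracket'_def \<alpha>'_def multiplicative)
  qed
  show "hom_lie_isomorphism scale bracket \<alpha> scale bracket' \<alpha>' f"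
    using f by (auto simp: hom_lie_isomorphism_def bracket'_def \<alpha>'_def)
qed

lemma hom_lie_isomorphism_refl: "hom_lie_isomorphism scale bracket \<alpha> scale bracket \<alpha> id"
  using linear_id by (simp add: hom_lie_isomorphism_def)

end

theorem proposition2p7:
  fixes scale :: "complex \<Rightarrow> 'v::ab_group_add \<Rightarrow> 'v"
    and bracket :: "'v \<Rightarrow> 'v \<Rightarrow> 'v"
    and \<alpha> :: "'v \<Rightarrow> 'v"
    and a :: "2 \<Rightarrow> 'v"
  assumes "mult_hom_lie_algebra scale bracket \<alpha>"
    and "vector_space.dim scale (UNIV :: 'v set) = 2"
    and "vector_space.basis_family scale a"
  shows "\<exists>bracket' \<alpha>'.
    mult_hom_lie_algebra scale bracket' \<alpha>' \<and>
    (\<exists>f. hom_lie_isomorphism scale bracket \<alpha> scale bracket' \<alpha>' f) \<and>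
    ((\<forall>x y. bracket' x y = 0) \<or>
     (standard_bracket a bracket' \<and>
       (\<exists>\<alpha>12 \<alpha>22. vector_space.represented_by scale a \<alpha>'
          (vector [vector [0, \<alpha>12], vector [0, \<alpha>22]]))) \<or>
     (standard_bracket a bracket' \<and>
       (\<exists>\<alpha>11 \<alpha>12. \<alpha>11 \<noteq> 0 \<and> vector_space.represented_by scale a \<alpha>'
          (vector [vector [\<alpha>11, \<alpha>12], vector [0, 1]]))))"
proof -
  interpret mult_hom_lie_algebra scale bracket \<alpha> by (rule assms(1))
  note a = assms(3)
  let ?w = "bracket (a 1) (a 2)"
  have multiple: "\<exists>c. bracket x y = scale c ?w" for x y
    using basis_family_2_coordinates[OF a, of x] basis_family_2_coordinates[OF a, of y]
      bracket_combinations by metis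
  show ?thesis
  proof (cases "?w = 0")
    case True
    with multiple have "\<forall>x y. bracket x y = 0" by (metis scale_zero_right)
    with assms(1) hom_lie_isomorphism_refl show ?thesis by blast
  next
    case False
    obtain b :: "2 \<Rightarrow> 'v" where b: "basis_family b" "b 1 = ?w" "bracket (b 1) (b 2) = b 1"
      using normalised_basis_exists[OF a False] by blast
    obtain f where f: "Vector_Spaces.linear scale scale f" "bij f" "\<And>i. f (b i) = a i"
      using linear_bij_between_basis_families[OF a b(1)] by blast
    interpret f: Vector_Spaces.linear scale scale f by (rule f(1))
    have inv_a: "inv f (a i) = b i" for i
      using f(2,3) by (metis bij_inv_eq_iff)
    define bracket' where "bracket' = (\<lambda>x y. f (bracket (inv f x) (inv f y)))"
    define \<alpha>' where "\<alpha>' = f \<circ> \<alpha> \<circ> inv f"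
    have struct: "mult_hom_lie_algebra scale bracket' \<alpha>'"
        "hom_lie_isomorphism scale bracket \<alpha> scale bracket' \<alpha>' f"
      unfolding bracket'_def \<alpha>'_def by (rule transport[OF f(1,2)])+
    have "bracket (b 2) (b 1) = - b 1"
      using skew[of "b 2" "b 1"] b(3) by simp
    then have std: "standard_bracket a bracket'"
      by (simp add: standard_bracket_def bracket'_def inv_a b(3) bracket_self f(3) f.neg f.zero)
    have twist_b1: "\<alpha> (b 1) = bracket (\<alpha> (b 1)) (\<alpha> (b 2))"
      using multiplicative[of "b 1" "b 2"] b(3) by simp
    then obtain k where k: "\<alpha> (b 1) = scale k (b 1)"
      using multiple b(2) by metis
    obtain m n where mn: "\<alpha> (b 2) = scale m (b 1) + scale n (b 2)"
      using basis_family_2_coordinates[OF b(1)] by blast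
    have "scale k (b 1) = scale (k * n) (b 1)"
      using twist_b1 unfolding k mn by (simp add: bracket_bilinear bracket_self b(3))
    then have kn: "k = 0 \<or> n = 1"
      using False b(2) by auto
    have rep: "represented_by a \<alpha>' (vector [vector [k, m], vector [0, n]])"
      by (simp add: represented_by_def forall_2 sum_2 \<alpha>'_def inv_a k mn f.add f.scale f(3))
    show ?thesis
    proof (cases "k = 0")
      case True
      with struct std rep show ?thesis by blast
    next
      case False
      with kn struct std rep show ?thesis by blast
    qed
  qed
qed

end
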